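(* Let $X,E$ be Euclidean spaces, let $A:X\to\mathbf{R}^m$ and $B:X\to E$ be linear maps, and let a sparsity structure $(\|\cdot\|,\mathcal{P},\nu,P\mapsto\overline{P})$ on $E$ be given. Let $w\in E$ and $P\in\mathcal{P}$ be such that $Pw=w$. Then for every $z\in X$ one has $$\|w+Bz\|\ \geq\ \|w\|+\|\overline{P}Bz\|-\|PBz\|.$$ In particular, for $s\ge 0$, if the following nullspace property holds true: $$\forall P\in\mathcal{P}_s,\ \forall z\in\mathrm{Ker}(A)\text{ with }Bz\neq0:\quad \|\overline{P}Bz\|>\|PBz\|,$$ then $A$ is $s$-good.
   Context: Sparsity structure on a Euclidean space $E$: a norm $\|\cdot\|$ on $E$, with conjugate (dual) norm $\|\cdot\|_*$, together with a family $\mathcal{P}$ of linear maps of $E$ into itself such that: (A.1) every $P\in\mathcal{P}$ is a projector, $P^2=P$; (A.2) every $P\in\mathcal{P}$ is assigned a nonnegative weight $\nu(P)$ and a linear map $\overline{P}$ on $E$ such that $\overline{P}P=0$; (A.3) whenever $P\in\mathcal{P}$ and $f,g\in E$, one has $\|P^*f+\overline{P}^*g\|_*\le\max[\|f\|_*,\|g\|_*]$, where $Q^*$ denotes the conjugate (adjoint) of a linear map $Q$. For real $s\ge0$, $\mathcal{P}_s=\{P\in\mathcal{P}:\nu(P)\le s\}$. A vector $w\in E$ is $s$-sparse if there exists $P\in\mathcal{P}$ with $\nu(P)\le s$ and $Pw=w$; a vector $x\in X$ is $s$-sparse if $Bx$ is $s$-sparse. $A$ is called $s$-good if the noiseless recovery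 by $\|\cdot\|$-minimization reproduces exactly $Bx$ for every $s$-sparse $x$, i.e., for every $s$-sparse $x\in X$, every $\widehat{x}\in\mathrm{Argmin}_{u\in X}\{\|Bu\|: Au=Ax\}$ satisfies $B\widehat{x}=Bx$. *)

theory Defs
  imports "HOL-Analysis.Analysis"
begin

text \<open>
  The norm of a sparsity structure is an arbitrary one, unrelated to the Euclidean \<^const>\<open>norm\<close>
  of the type; the latter's inner product serves only to define conjugate norms and adjoints.
\<close>

definition is_norm :: "('e::real_vector \<Rightarrow> real) \<Rightarrow> bool" where
  "is_norm N \<longleftrightarrow>
     (\<forall>x. 0 \<le> N x) \<and>
     (\<forall>x. N x = 0 \<longleftrightarrow> x = 0) \<and>
     (\<forall>c x. N (c *\<^sub>R x) = \<bar>c\<bar> * N x) \<and>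
     (\<forall>x y. N (x + y) \<le> N x + N y)"

definition conjugate_norm :: "('e::real_inner \<Rightarrow> real) \<Rightarrow> 'e \<Rightarrow> real" where
  "conjugate_norm N f = (SUP x\<in>{x. N x \<le> 1}. f \<bullet> x)"

text \<open>
  \<open>\<P>\<close> is the family of projectors, \<open>\<nu> P\<close> the weight of \<open>P\<close> and \<open>bar P\<close> the map written
  \<open>P\<close> with an overline in the literature. The values of \<open>\<nu>\<close> and \<open>bar\<close> outside \<open>\<P>\<close> are irrelevant.
\<close>

locale sparsity_structure =
  fixes N :: "'e::euclidean_space \<Rightarrow> real"
    and \<P> :: "('e \<Rightarrow> 'e) set"
    and \<nu> :: "('e \<Rightarrow> 'e) \<Rightarrow> real"
    and bar :: "('e \<Rightarrow> 'e) \<Rightarrow> 'e \<Rightarrow> 'e"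
  assumes norm_N: "is_norm N"
    and linear_P: "\<And>P. P \<in> \<P> \<Longrightarrow> linear P"
    and projector: "\<And>P. P \<in> \<P> \<Longrightarrow> P \<circ> P = P"
    and weight_nonneg: "\<And>P. P \<in> \<P> \<Longrightarrow> 0 \<le> \<nu> P"
    and linear_bar: "\<And>P. P \<in> \<P> \<Longrightarrow> linear (bar P)"
    and bar_comp: "\<And>P. P \<in> \<P> \<Longrightarrow> bar P \<circ> P = (\<lambda>_. 0)"
    and conjugate_norm_le: "\<And>P f g. P \<in> \<P> \<Longrightarrow>
      conjugate_norm N (adjoint P f + adjoint (bar P) g)
        \<le> max (conjugate_norm N f) (conjugate_norm N g)"

definition projectors_upto ::
  "('e \<Rightarrow> 'e) set \<Rightarrow> (('e \<Rightarrow> 'e) \<Rightarrow> real) \<Rightarrow> real \<Rightarrow> ('e \<Rightarrow> 'e) set" where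
  "projectors_upto \<P> \<nu> s = {P \<in> \<P>. \<nu> P \<le> s}"

definition sparse ::
  "('e \<Rightarrow> 'e) set \<Rightarrow> (('e \<Rightarrow> 'e) \<Rightarrow> real) \<Rightarrow> real \<Rightarrow> 'e \<Rightarrow> bool" where
  "sparse \<P> \<nu> s w \<longleftrightarrow> (\<exists>P\<in>\<P>. \<nu> P \<le> s \<and> P w = w)"

definition s_good ::
  "('e \<Rightarrow> real) \<Rightarrow> ('e \<Rightarrow> 'e) set \<Rightarrow> (('e \<Rightarrow> 'e) \<Rightarrow> real) \<Rightarrow>
   ('x \<Rightarrow> 'e) \<Rightarrow> ('x \<Rightarrow> 'y) \<Rightarrow> real \<Rightarrow> bool" where
  "s_good N \<P> \<nu> B A s \<longleftrightarrow>
     (\<forall>x. sparse \<P> \<nu> s (B x) \<longrightarrow>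
       (\<forall>x'. is_arg_min (\<lambda>u. N (B u)) (\<lambda>u. A u = A x) x' \<longrightarrow> B x' = B x))"

end

theory Submission
  imports Defs
begin

text \<open>
  Let \<open>u = w + B z\<close>. Since \<open>bar P w = bar P (P w) = 0\<close>, we have \<open>P u = w + P (B z)\<close> and
  \<open>bar P u = bar P (B z)\<close>. Choose \<open>f\<close> and \<open>g\<close> of conjugate norm at most 1 that norm \<open>P u\<close> and
  \<open>bar P u\<close>. By (A.3) the functional \<open>P\<^sup>* f + (bar P)\<^sup>* g\<close> has conjugate norm at most 1, and its
  value at \<open>u\<close> is \<open>N (P u) + N (bar P u)\<close>, so \<open>N u\<close> is at least that sum. Under the nullspace
  property, a feasible \<open>x'\<close> with \<open>B x' \<noteq> B x\<close> therefore has \<open>N (B x') > N (B x)\<close>.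
\<close>

lemma
  assumes "is_norm N"
  shows is_norm_nonneg: "0 \<le> N x"
    and is_norm_eq_0_iff: "N x = 0 \<longleftrightarrow> x = 0"
    and is_norm_scaleR: "N (c *\<^sub>R x) = \<bar>c\<bar> * N x"
    and is_norm_triangle: "N (x + y) \<le> N x + N y"
  using assms unfolding is_norm_def by auto

lemma is_norm_zero:
  assumes "is_norm N"
  shows "N 0 = 0"
  by (simp only: is_norm_eq_0_iff[OF assms])

lemma is_norm_diff_ineq:
  assumes "is_norm N"
  shows "N x - N y \<le> N (x + y)"
proof -
  have "N x = N ((x + y) + (-1) *\<^sub>R y)" by simp
  also have "\<dots> \<le> N (x + y) + N ((-1) *\<^sub>R y)" by (rule is_norm_triangle[OF assms])
  finally show ?thesis by (simp only: is_norm_scaleR[OF assms])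
qed

text \<open>Convexity serves twice: it makes \<open>N\<close> continuous in finite dimension, and it
  makes the open balls of \<open>N\<close> convex, ready for separation.\<close>

lemma is_norm_convex_on:
  assumes "is_norm N"
  shows "convex_on UNIV N"
proof (rule convex_onI)
  fix t :: real and x y :: 'a
  assume "0 < t" "t < 1"
  then show "N ((1 - t) *\<^sub>R x + t *\<^sub>R y) \<le> (1 - t) * N x + t * N y"
    using is_norm_triangle[OF assms, of "(1 - t) *\<^sub>R x" "t *\<^sub>R y"]
    by (simp add: is_norm_scaleR[OF assms])
qed simp

text \<open>By compactness \<open>N\<close> attains its minimum on the Euclidean unit sphere; this
  minimum is positive, and homogeneity carries the bound to all vectors.\<close>

lemma is_norm_ge_norm:
  fixes N :: "'e::euclidean_space \<Rightarrow> real"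
  assumes "is_norm N"
  obtains m where "0 < m" "\<And>x. m * norm x \<le> N x"
proof -
  have "continuous_on (sphere 0 1) N"
    using convex_on_continuous[OF open_UNIV is_norm_convex_on[OF assms]] continuous_on_subset
    by blast
  moreover have "sphere (0::'e) 1 \<noteq> {}" by simp
  ultimately obtain y where y: "y \<in> sphere 0 1" "\<And>x. x \<in> sphere 0 1 \<Longrightarrow> N y \<le> N x"
    using continuous_attains_inf[OF compact_sphere] by metis
  show thesis
  proof
    show "0 < N y"
      using y(1) is_norm_nonneg[OF assms, of y] is_norm_eq_0_iff[OF assms, of y]
      by (cases "y = 0") auto
    fix x :: 'e
    show "N y * norm x \<le> N x"
    proof (cases "x = 0")
      case False
      then have "N y \<le> N ((1 / norm x) *\<^sub>R x)" by (intro y(2)) simp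
      then show ?thesis using False by (simp add: is_norm_scaleR[OF assms] field_simps)
    qed (simp add: is_norm_zero[OF assms])
  qed
qed

lemma inner_le_conjugate_norm:
  fixes N :: "'e::euclidean_space \<Rightarrow> real"
  assumes "is_norm N"
  shows "f \<bullet> x \<le> conjugate_norm N f * N x"
proof (cases "x = 0")
  case False
  obtain m where m: "0 < m" "\<And>x. m * norm x \<le> N x"
    using is_norm_ge_norm[OF assms] by blast
  \<comment> \<open>A real \<open>SUP\<close> dominates its values only if they are bounded above,
    so boundedness of the unit ball of \<open>N\<close> comes first.\<close>
  have "f \<bullet> y \<le> norm f * (1 / m)" if "N y \<le> 1" for y
  proof -
    have "norm y \<le> 1 / m" using m(2)[of y] that m(1) by (simp add: field_simps)
    then show ?thesis
      using norm_cauchy_schwarz[of f y] mult_left_mono[of "norm y" "1 / m" "norm f"] by simp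
  qed
  then have bdd: "bdd_above ((\<lambda>y. f \<bullet> y) ` {y. N y \<le> 1})" by (intro bdd_aboveI2) auto
  have pos: "0 < N x"
    using False is_norm_nonneg[OF assms, of x] is_norm_eq_0_iff[OF assms, of x] by linarith
  then have "N ((1 / N x) *\<^sub>R x) \<le> 1" by (simp add: is_norm_scaleR[OF assms])
  then have "f \<bullet> ((1 / N x) *\<^sub>R x) \<le> conjugate_norm N f"
    unfolding conjugate_norm_def by (intro cSUP_upper[OF _ bdd]) simp
  then show ?thesis using pos by (simp add: field_simps)
qed (simp add: is_norm_zero[OF assms])

lemma conjugate_norm_leI:
  assumes "is_norm N" and "\<And>x. N x \<le> 1 \<Longrightarrow> f \<bullet> x \<le> c"
  shows "conjugate_norm N f \<le> c"
proof -
  have "0 \<in> {x. N x \<le> 1}" using is_norm_zero[OF assms(1)] by auto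
  then show ?thesis unfolding conjugate_norm_def
    using assms(2) by (intro cSUP_least) auto
qed

text \<open>Finite-dimensional Hahn-Banach: a hyperplane separates \<open>v\<close> from the open
  ball of radius \<open>N v\<close>, and its normal, suitably rescaled, is the functional.\<close>

lemma norming_functional_exists:
  fixes N :: "'e::euclidean_space \<Rightarrow> real"
  assumes "is_norm N"
  obtains f where "conjugate_norm N f \<le> 1" "f \<bullet> v = N v"
proof (cases "v = 0")
  \<comment> \<open>For \<open>v = 0\<close> the open ball used below would be empty.\<close>
  case True
  show thesis
    by (rule that[of 0]) (use True in \<open>auto intro: conjugate_norm_leI[OF assms]
      simp: is_norm_zero[OF assms]\<close>)
next
  case False
  have v: "0 < N v"
    using False is_norm_nonneg[OF assms, of v] is_norm_eq_0_iff[OF assms, of v] by linarith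
  define S where "S = {x. N x < N v}"
  have "convex S"
    unfolding S_def convex_alt
  proof (intro ballI allI impI)
    fix x y :: 'e and t :: real
    assume "x \<in> {x. N x < N v}" "y \<in> {x. N x < N v}" "0 \<le> t \<and> t \<le> 1"
    then show "(1 - t) *\<^sub>R x + t *\<^sub>R y \<in> {x. N x < N v}"
      using convex_onD[OF is_norm_convex_on[OF assms], of t x y]
        convex_bound_lt[of "N x" "N v" "N y" "1 - t" t]
      by simp
  qed
  moreover have "0 \<in> S" using v by (simp add: S_def is_norm_zero[OF assms])
  moreover have "S \<inter> {v} = {}" by (simp add: S_def)
  ultimately obtain a b where ab: "a \<noteq> 0" "\<forall>x\<in>S. a \<bullet> x \<le> b" "b \<le> a \<bullet> v"
    using separating_hyperplane_sets[of S "{v}"] by auto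
  have sep: "a \<bullet> x \<le> a \<bullet> v" if "N x < N v" for x
    using ab(2,3) that by (force simp: S_def)
  \<comment> \<open>The multiple of \<open>a\<close> with \<open>N\<close>-value
    \<open>N v / 2\<close> lies in \<open>S\<close> and pairs positively with
    \<open>a\<close>.\<close>
  have "0 < a \<bullet> v"
  proof -
    have "0 < N a"
      using ab(1) is_norm_nonneg[OF assms, of a] is_norm_eq_0_iff[OF assms, of a] by linarith
    then have "a \<bullet> ((N v / (2 * N a)) *\<^sub>R a) \<le> a \<bullet> v"
      using v by (intro sep) (simp add: is_norm_scaleR[OF assms])
    moreover have "0 < a \<bullet> ((N v / (2 * N a)) *\<^sub>R a)"
      using \<open>0 < N a\<close> v ab(1) by simp
    ultimately show ?thesis by linarith
  qed
  have unit: "(N v / (a \<bullet> v)) *\<^sub>R a \<bullet> x \<le> 1" if "N x \<le> 1" for x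
  proof -
    \<comment> \<open>\<open>N v *\<^sub>R x\<close> may lie on the boundary of the ball, outside
      \<open>S\<close>; shrinking by \<open>t < 1\<close> moves it inside, and then \<open>t\<close>
      tends to 1.\<close>
    have "t * (N v * (a \<bullet> x)) \<le> a \<bullet> v" if t: "0 < t" "t < 1" for t
    proof -
      have "t * N v * N x \<le> t * N v * 1"
        using t v \<open>N x \<le> 1\<close> by (intro mult_left_mono) auto
      also have "\<dots> < N v" using t v by simp
      finally show ?thesis
        using sep[of "(t * N v) *\<^sub>R x"] t v by (simp add: is_norm_scaleR[OF assms] mult_ac)
    qed
    then have "N v * (a \<bullet> x) \<le> a \<bullet> v" by (rule field_le_mult_one_interval)
    then show ?thesis using \<open>0 < a \<bullet> v\<close> by (simp add: field_simps)
  qed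
  show thesis
    by (rule that[of "(N v / (a \<bullet> v)) *\<^sub>R a"])
      (use \<open>0 < a \<bullet> v\<close> in \<open>auto intro: conjugate_norm_leI[OF assms unit]\<close>)
qed

context sparsity_structure
begin

text \<open>This is the dual form of (A.3): a bound by the maximum of two conjugate norms becomes a
  bound on the sum of two norms.\<close>

lemma norm_projector_add_norm_bar_le:
  assumes P: "P \<in> \<P>"
  shows "N (P u) + N (bar P u) \<le> N u"
proof -
  obtain f where f: "conjugate_norm N f \<le> 1" "f \<bullet> P u = N (P u)"
    using norming_functional_exists[OF norm_N] .
  obtain g where g: "conjugate_norm N g \<le> 1" "g \<bullet> bar P u = N (bar P u)"
    using norming_functional_exists[OF norm_N] .
  let ?h = "adjoint P f + adjoint (bar P) g"
  have "N (P u) + N (bar P u) = ?h \<bullet> u"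
    using f(2) g(2) by (simp add: inner_add_left adjoint_clauses linear_P[OF P] linear_bar[OF P])
  also have "\<dots> \<le> conjugate_norm N ?h * N u" by (rule inner_le_conjugate_norm[OF norm_N])
  also have "\<dots> \<le> 1 * N u"
    using conjugate_norm_le[OF P, of f g] f(1) g(1)
    by (intro mult_right_mono is_norm_nonneg[OF norm_N]) auto
  finally show ?thesis by simp
qed

lemma norm_add_ge:
  assumes P: "P \<in> \<P>" and w: "P w = w"
  shows "N w + N (bar P y) - N (P y) \<le> N (w + y)"
proof -
  have "bar P w = 0" using fun_cong[OF bar_comp[OF P], of w] w by simp
  then have "N (w + P y) + N (bar P y) \<le> N (w + y)"
    using norm_projector_add_norm_bar_le[OF P, of "w + y"] w
    by (simp add: linear_add linear_P[OF P] linear_bar[OF P])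
  \<comment> \<open>The reverse triangle inequality splits \<open>N (w + P y)\<close>.\<close>
  then show ?thesis using is_norm_diff_ineq[OF norm_N, of w "P y"] by linarith
qed

lemma nullspace_property_imp_s_good:
  assumes "linear A" "linear B"
    and nullspace: "\<And>P z. P \<in> projectors_upto \<P> \<nu> s \<Longrightarrow> A z = 0 \<Longrightarrow> B z \<noteq> 0 \<Longrightarrow>
      N (P (B z)) < N (bar P (B z))"
  shows "s_good N \<P> \<nu> B A s"
  unfolding s_good_def
proof (intro allI impI)
  fix x x'
  assume "sparse \<P> \<nu> s (B x)" and x': "is_arg_min (\<lambda>u. N (B u)) (\<lambda>u. A u = A x) x'"
  then obtain P where P: "P \<in> \<P>" "\<nu> P \<le> s" "P (B x) = B x" by (auto simp: sparse_def)
  have A: "A (x' - x) = 0" and B: "B (x' - x) = B x' - B x"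
    using x' by (simp_all add: is_arg_min_def linear_diff assms(1,2))
  show "B x' = B x"
  proof (rule ccontr)
    assume "B x' \<noteq> B x"
    then have "N (P (B (x' - x))) < N (bar P (B (x' - x)))"
      using P A B by (intro nullspace) (auto simp: projectors_upto_def)
    \<comment> \<open>Here \<open>w = B x\<close> and \<open>z = x' - x\<close>, so
      \<open>w + B z = B x'\<close>. Since \<open>x\<close> is itself feasible, this contradicts the
      minimality of \<open>x'\<close>.\<close>
    then have "N (B x) < N (B x')" using norm_add_ge[OF P(1,3), of "B (x' - x)"] B by simp
    then show False using x' by (auto simp: is_arg_min_def)
  qed
qed

end

theorem lemma3p1:
  fixes A :: "'x::euclidean_space \<Rightarrow> real ^ 'm"
    and B :: "'x \<Rightarrow> 'e::euclidean_space"
    and N :: "'e \<Rightarrow> real"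
    and \<P> :: "('e \<Rightarrow> 'e) set"
    and \<nu> :: "('e \<Rightarrow> 'e) \<Rightarrow> real"
    and bar :: "('e \<Rightarrow> 'e) \<Rightarrow> 'e \<Rightarrow> 'e"
  assumes "linear A" and "linear B"
    and "sparsity_structure N \<P> \<nu> bar"
  shows "(\<forall>w. \<forall>P\<in>\<P>. P w = w \<longrightarrow>
            (\<forall>z. N (w + B z) \<ge> N w + N (bar P (B z)) - N (P (B z))))
       \<and> (\<forall>s\<ge>0.
            (\<forall>P\<in>projectors_upto \<P> \<nu> s. \<forall>z. A z = 0 \<and> B z \<noteq> 0 \<longrightarrow>
               N (bar P (B z)) > N (P (B z)))
            \<longrightarrow> s_good N \<P> \<nu> B A s)"
proof -
  interpret sparsity_structure N \<P> \<nu> bar by fact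
  show ?thesis
  proof (intro conjI allI ballI impI)
    fix w P z
    assume "P \<in> \<P>" "P w = w"
    then show "N (w + B z) \<ge> N w + N (bar P (B z)) - N (P (B z))" by (rule norm_add_ge)
  next
    fix s
    assume "\<forall>P\<in>projectors_upto \<P> \<nu> s. \<forall>z. A z = 0 \<and> B z \<noteq> 0 \<longrightarrow>
      N (bar P (B z)) > N (P (B z))"
    then show "s_good N \<P> \<nu> B A s"
      by (intro nullspace_property_imp_s_good[OF assms(1,2)]) simp
  qed
qed

end
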